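(* For integer $x\ge0$ let $$\Omega(x)=\frac{1}{2\pi}\left(\int_{-\pi}^{\pi}\left(\frac{\cos(x\xi)}{2(1-\cos\xi)}-\frac{1}{\xi^2}\right)d\xi-\frac{2}{\pi}\right)+\frac x2.$$ Then $\Omega(x)=0$ for all integers $x\ge0$. *)

theory Defs
  imports "HOL-Analysis.Analysis"
begin

text \<open>
  The singularities of the two summands at \<open>\<xi> = 0\<close> cancel, so the integrand is bounded and the
  integral is an ordinary Lebesgue integral; the value that division by zero produces at the
  single point \<open>\<xi> = 0\<close> does not affect it.
\<close>

definition \<Omega> :: "nat \<Rightarrow> real" where
  "\<Omega> x = 1 / (2 * pi) *
     ((LBINT \<xi>:{-pi..pi}. cos (real x * \<xi>) / (2 * (1 - cos \<xi>)) - 1 / \<xi>\<^sup>2) - 2 / pi)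
     + real x / 2"

end

theory Submission
  imports Defs "HOL-Real_Asymp.Real_Asymp"
begin

text \<open>
  Split \<open>cos (n\<xi>)\<close> as \<open>1 - (1 - cos (n\<xi>))\<close>. The part without \<open>n\<close> has the antiderivative
  \<open>1/\<xi> - cot (\<xi>/2) / 2\<close>, which extends continuously by 0 to the origin, and its integral
  is \<open>2/\<pi>\<close>. The rest is the Fejer kernel \<open>K\<^sub>n(\<xi>) = (1 - cos (n\<xi>)) / (2 (1 - cos \<xi>))\<close>; it satisfies
  \<open>K\<^sub>n\<^sub>+\<^sub>2 = 2 K\<^sub>n\<^sub>+\<^sub>1 - K\<^sub>n + cos ((n+1)\<xi>)\<close> away from the origin, so its integral is affine in
  \<open>n\<close> and equals \<open>n\<pi>\<close>.
\<close>

lemma one_minus_cos_eq: "1 - cos t = 2 * (sin (t / 2))\<^sup>2" for t :: real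
  using cos_double_sin[of "t / 2"] by simp

lemma sin_half_neq_0:
  fixes t :: real
  assumes "t \<in> {-pi..pi}" "t \<noteq> 0"
  shows "sin (t / 2) \<noteq> 0"
proof (cases "t > 0")
  case True
  then show ?thesis using sin_gt_zero[of "t / 2"] assms by auto
next
  case False
  then show ?thesis using sin_gt_zero[of "- t / 2"] assms by auto
qed

lemma has_integral_inverse_one_minus_cos_diff:
  "((\<lambda>t. 1 / (2 * (1 - cos t)) - 1 / t\<^sup>2) has_integral 2 / pi) {-pi..pi}"
proof -
  define F :: "real \<Rightarrow> real" where "F = (\<lambda>t. 1 / t - cos (t / 2) / (2 * sin (t / 2)))"
  have deriv: "(F has_real_derivative 1 / (2 * (1 - cos t)) - 1 / t\<^sup>2) (at t)"
    if t: "t \<in> {-pi..pi}" "t \<noteq> 0" for t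
  proof -
    have s: "sin (t / 2) \<noteq> 0" by (rule sin_half_neq_0[OF t])
    have "((\<lambda>t. cos (t / 2) / (2 * sin (t / 2))) has_real_derivative
        (- sin (t / 2) / 2 * (2 * sin (t / 2)) - cos (t / 2) * cos (t / 2)) /
        (2 * sin (t / 2))\<^sup>2) (at t)"
      by (rule derivative_eq_intros refl | use s in \<open>simp add: power2_eq_square\<close>)+
    also have "- sin (t / 2) / 2 * (2 * sin (t / 2)) - cos (t / 2) * cos (t / 2) = -1"
      using sin_cos_squared_add3[of "t / 2"] by (simp add: algebra_simps)
    also have "(2 * sin (t / 2))\<^sup>2 = 2 * (1 - cos t)"
      by (simp add: one_minus_cos_eq power2_eq_square)
    finally have "((\<lambda>t. cos (t / 2) / (2 * sin (t / 2))) has_real_derivative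
        - 1 / (2 * (1 - cos t))) (at t)" .
    moreover have "((\<lambda>t. 1 / t) has_real_derivative - (1 / t\<^sup>2)) (at t)"
      using DERIV_inverse[OF t(2)] by (simp add: field_simps power2_eq_square)
    ultimately show ?thesis
      unfolding F_def using DERIV_diff by force
  qed
  \<comment> \<open>Division by zero gives \<open>F 0 = 0\<close>, which is also the limit:
    \<open>F t\<close> behaves like \<open>t / 12\<close> near 0. Its derivative 1/12 differs from
    the integrand's default value 0 there, so the origin is excepted below.\<close>
  have "isCont F 0"
    unfolding F_def isCont_def by simp real_asymp
  then have "isCont F t" if "t \<in> {-pi..pi}" for t
    using deriv[OF that] DERIV_isCont by (cases "t = 0") auto
  then have cont: "continuous_on {-pi..pi} F"
    by (intro continuous_at_imp_continuous_on) blast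
  have "((\<lambda>t. 1 / (2 * (1 - cos t)) - 1 / t\<^sup>2) has_integral (F pi - F (-pi))) {-pi..pi}"
  proof (rule fundamental_theorem_of_calculus_interior_strong[where S = "{0}"])
    fix t assume "t \<in> {-pi<..<pi} - {0}"
    then show "(F has_vector_derivative 1 / (2 * (1 - cos t)) - 1 / t\<^sup>2) (at t)"
      using deriv[of t] by (simp add: has_real_derivative_iff_has_vector_derivative)
  qed (use cont in auto)
  \<comment> \<open>The cotangent term vanishes at both endpoints, leaving 1/pi and -1/pi.\<close>
  then show ?thesis by (simp add: F_def)
qed

text \<open>Makes the part without \<open>n\<close> nonnegative, as the passage to the Lebesgue
  integral requires. It comes from |sin u| \<le> |u| at u = t/2; at t = 0 both quotients are 0 by
  convention.\<close>

lemma inverse_square_le_inverse_one_minus_cos: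
  fixes t :: real
  assumes "t \<in> {-pi..pi}"
  shows "1 / t\<^sup>2 \<le> 1 / (2 * (1 - cos t))"
proof (cases "t = 0")
  case False
  have "\<bar>sin (t / 2)\<bar> \<le> \<bar>t / 2\<bar>" by (rule abs_sin_x_le_abs_x)
  then have "(sin (t / 2))\<^sup>2 \<le> (t / 2)\<^sup>2" by (simp only: abs_le_square_iff)
  then have "2 * (1 - cos t) \<le> t\<^sup>2" by (simp add: one_minus_cos_eq power_divide)
  moreover have "0 < 2 * (1 - cos t)"
    using sin_half_neq_0[OF assms False] by (simp add: one_minus_cos_eq)
  ultimately show ?thesis by (intro frac_le) auto
qed simp

lemma has_integral_cos_of_nat_mult:
  fixes n :: nat
  assumes "n > 0"
  shows "((\<lambda>t. cos (real n * t)) has_integral 0) {-pi..pi}"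
proof -
  have "((\<lambda>t. cos (real n * t)) has_integral
      (sin (real n * pi) / real n - sin (real n * - pi) / real n)) {-pi..pi}"
  proof (rule fundamental_theorem_of_calculus)
    fix t
    show "((\<lambda>t. sin (real n * t) / real n) has_vector_derivative cos (real n * t))
        (at t within {-pi..pi})"
      unfolding has_real_derivative_iff_has_vector_derivative[symmetric]
      by (rule derivative_eq_intros refl | use assms in simp)+
  qed simp
  then show ?thesis by simp
qed

lemma has_integral_Fejer_kernel:
  fixes n :: nat
  shows "((\<lambda>t. (1 - cos (real n * t)) / (2 * (1 - cos t))) has_integral real n * pi) {-pi..pi}"
proof (induction n rule: induct_nat_012)
  case 0
  show ?case by simp
next
  case 1
  have "((\<lambda>t. 1 / 2 :: real) has_integral pi) {-pi..pi}"
    using has_integral_const_real[of "1 / 2 :: real" "-pi" pi] by simp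
  then have "((\<lambda>t. (1 - cos t) / (2 * (1 - cos t))) has_integral pi) {-pi..pi}"
  proof (rule has_integral_spike_finite[where S = "{0}", rotated 2])
    fix t assume "t \<in> {-pi..pi} - {0}"
    then show "(1 - cos t) / (2 * (1 - cos t)) = 1 / 2"
      using sin_half_neq_0[of t] by (simp add: one_minus_cos_eq)
  qed simp
  then show ?case by simp
next
  case (ge2 n)
  let ?K = "\<lambda>n t. (1 - cos (real n * t)) / (2 * (1 - cos t))"
  have "((\<lambda>t. 2 * ?K (Suc n) t - ?K n t + cos (real (Suc n) * t)) has_integral
      2 * (real (Suc n) * pi) - real n * pi + 0) {-pi..pi}"
    by (intro has_integral_add has_integral_diff has_integral_mult_right ge2
        has_integral_cos_of_nat_mult) simp
  then have "(?K (Suc (Suc n)) has_integral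
      2 * (real (Suc n) * pi) - real n * pi + 0) {-pi..pi}"
  \<comment> \<open>At the origin the recurrence fails: every \<open>?K\<close> is 0 there by
    division by zero, but the cosine is 1.\<close>
  proof (rule has_integral_spike_finite[where S = "{0}", rotated 2])
    fix t assume "t \<in> {-pi..pi} - {0}"
    then have "1 - cos t \<noteq> 0"
      using sin_half_neq_0[of t] by (simp add: one_minus_cos_eq)
    moreover have "cos (real (Suc (Suc n)) * t) + cos (real n * t) = 2 * cos (real (Suc n) * t) * cos t"
      using cos_add[of "real (Suc n) * t" t] cos_diff[of "real (Suc n) * t" t]
      by (simp add: algebra_simps)
    ultimately show "?K (Suc (Suc n)) t = 2 * ?K (Suc n) t - ?K n t + cos (real (Suc n) * t)"
      by (simp add: divide_simps) (simp add: algebra_simps)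
  qed simp
  then show ?case by (simp add: algebra_simps)
qed

text \<open>Bridge from the gauge integral to the Lebesgue integral: for nonnegative functions,
  gauge integrability is already absolute integrability, and Borel measurability brings it from the
  completed measure down to \<open>lborel\<close>.\<close>

lemma set_integral_lborel_nonneg_eq:
  fixes f :: "real \<Rightarrow> real"
  assumes meas: "f \<in> borel_measurable borel" and A: "A \<in> sets borel"
    and int: "(f has_integral I) A" and nonneg: "\<And>t. t \<in> A \<Longrightarrow> 0 \<le> f t"
  shows "set_integrable lborel A f" "(LBINT t:A. f t) = I"
proof -
  have "f absolutely_integrable_on A"
    using int nonneg by (intro nonnegative_absolutely_integrable_1) auto
  then show *: "set_integrable lborel A f"
    using meas A unfolding set_integrable_def by (subst (asm) integrable_completion) auto
  then show "(LBINT t:A. f t) = I"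
    using set_borel_integral_eq_integral(2)[OF *] int by (simp add: integral_unique)
qed

theorem lemmaB1:
  fixes x :: nat
  shows "\<Omega> x = 0"
proof -
  let ?h = "\<lambda>t :: real. 1 / (2 * (1 - cos t)) - 1 / t\<^sup>2"
  let ?K = "\<lambda>t. (1 - cos (real x * t)) / (2 * (1 - cos t))"
  have h: "set_integrable lborel {-pi..pi} ?h" "(LBINT t:{-pi..pi}. ?h t) = 2 / pi"
    by (rule set_integral_lborel_nonneg_eq[OF _ _ has_integral_inverse_one_minus_cos_diff];
        use inverse_square_le_inverse_one_minus_cos in \<open>simp del: atLeastAtMost_iff\<close>)+
  have K: "set_integrable lborel {-pi..pi} ?K" "(LBINT t:{-pi..pi}. ?K t) = real x * pi"
    by (rule set_integral_lborel_nonneg_eq[OF _ _ has_integral_Fejer_kernel]; simp)+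
  \<comment> \<open>The singular terms stay paired inside \<open>?h\<close>, so both pieces are
    integrable. The identity holds even at t = 0, since it only splits a numerator.\<close>
  have "cos (real x * t) / (2 * (1 - cos t)) - 1 / t\<^sup>2 = ?h t - ?K t" for t
    by (simp add: diff_divide_distrib)
  then have "(LBINT t:{-pi..pi}. cos (real x * t) / (2 * (1 - cos t)) - 1 / t\<^sup>2) = 2 / pi - real x * pi"
    using h K by (simp only: set_integral_diff(2))
  then show ?thesis by (simp only: \<Omega>_def) simp
qed

end
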